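(* Let $S=\langle m,n_2,\ldots,n_k\rangle$ be a numerical semigroup contained in the face $F\subset\mathcal{C}(\mathbb{Z}_m)$, and let $T=\langle\alpha\rangle+\beta S$ be a monoscopic gluing of $S$ contained in the face $F'\subset\mathcal{C}(\mathbb{Z}_{\beta m})$. Then $$\dim F'=\begin{cases}\dim F&\text{if }\alpha\in\operatorname{Ap}(S;m);\\ \dim F+1&\text{if }\alpha\notin\operatorname{Ap}(S;m).\end{cases}$$
   Context: A numerical semigroup is a subset $S \subseteq \mathbb{Z}_{\ge 0}$ containing $0$, closed under addition, with finite complement; $\langle n_1,\ldots,n_k\rangle$ denotes the set of all non-negative integer combinations of $n_1,\ldots,n_k$. For $m \in S$, $m>0$, the Apéry set $\operatorname{Ap}(S;m) = \{n \in S : n-m\notin S\}$ has exactly one element in each residue class modulo $m$; writing $\operatorname{Ap}(S;m) = \{0,a_1,\ldots,a_{m-1}\}$ with $a_i\equiv i \bmod m$, the Apéry tuple of $S$ (with respect to $m$) is $(a_1,\ldots,a_{m-1})$. For a positive integer $m$, the group cone $\mathcal{C}(\mathbb{Z}_m)\subset\mathbb{R}^{m-1}$ (coordinates indexed by $\mathbb{Z}_m\setminus\{0\}$) is the cone defined by the inequalities $x_i+x_j\ge x_{i+j}$ for $i,j\in\mathbb{Z}_m\setminus\{0\}$ with $i+j\ne 0$. A face $F$ of $\mathcal{C}(\mathbb{Z}_m)$ contains a numerical semigroup $S$ (with $m\in S$) if the Apéry tuple of $S$ with respect to $m$ lies in the relative interior of $F$. The dimension of a face is the dimension of its affine span. Monoscopic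 gluing: given a numerical semigroup $S=\langle n_1,\ldots,n_k\rangle$, an integer $\beta\ge 2$, and an element $\alpha\in S\setminus\{n_1,\ldots,n_k\}$ with $\gcd(\alpha,\beta)=1$, the numerical semigroup $T=\langle\alpha\rangle+\beta S=\langle\alpha,\beta n_1,\ldots,\beta n_k\rangle$ is called a monoscopic gluing of $S$ (here $n_1=m$). *)

theory Defs
  imports "HOL-Analysis.Analysis" "Berlekamp_Zassenhaus.Finite_Field"
begin

definition numerical_semigroup :: "nat set \<Rightarrow> bool" where
  "numerical_semigroup S \<longleftrightarrow>
     0 \<in> S \<and> (\<forall>a\<in>S. \<forall>b\<in>S. a + b \<in> S) \<and> finite (UNIV - S)"

definition semigroup_gen :: "nat list \<Rightarrow> nat set" where
  "semigroup_gen ns = {\<Sum>i<length ns. c i * ns ! i |c :: nat \<Rightarrow> nat. True}"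

text \<open>The guard \<open>m \<le> n\<close> is needed because subtraction on naturals truncates:
  a negative \<open>n - m\<close> is never in \<open>S\<close>.\<close>

definition apery :: "nat set \<Rightarrow> nat \<Rightarrow> nat set" where
  "apery S m = {n \<in> S. \<not> (m \<le> n \<and> n - m \<in> S)}"

text \<open>The group \<open>\<int>\<^sub>m\<close> is \<^typ>\<open>'m mod_ring\<close> for an index type with \<open>CARD('m) = m\<close>.
  The space \<open>\<real>\<^bsup>m-1\<^esup>\<close> with coordinates indexed by the nonzero residues is the hyperplane
  \<open>x $ 0 = 0\<close> of \<^typ>\<open>real ^ 'm mod_ring\<close>. This also covers \<open>m = 1\<close>, where it is a single point.
  Faces, relative interiors and affine dimensions do not depend on the ambient space.\<close>

definition group_cone :: "(real ^ 'm::finite mod_ring) set" where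
  "group_cone = {x. x $ 0 = 0 \<and>
     (\<forall>i j. i \<noteq> 0 \<longrightarrow> j \<noteq> 0 \<longrightarrow> i + j \<noteq> 0 \<longrightarrow> x $ i + x $ j \<ge> x $ (i + j))}"

definition apery_tuple :: "nat set \<Rightarrow> real ^ 'm::finite mod_ring" where
  "apery_tuple S = (\<chi> i. if i = 0 then 0
     else real (THE a. a \<in> apery S CARD('m) \<and> of_int_mod_ring (int a) = i))"

definition face_contains :: "(real ^ 'm::finite mod_ring) set \<Rightarrow> nat set \<Rightarrow> bool" where
  "face_contains F S \<longleftrightarrow> F face_of group_cone \<and> apery_tuple S \<in> rel_interior F"

text \<open>\<open>T\<close> is the monoscopic gluing \<open>\<langle>\<alpha>\<rangle> + \<beta>S\<close> of the semigroup \<open>S\<close> generated by \<open>ns\<close>.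
  The generators are part of the data because \<open>\<alpha>\<close> must not be one of them.\<close>

definition monoscopic_gluing :: "nat list \<Rightarrow> nat \<Rightarrow> nat \<Rightarrow> nat set \<Rightarrow> bool" where
  "monoscopic_gluing ns \<alpha> \<beta> T \<longleftrightarrow>
     \<beta> \<ge> 2 \<and> \<alpha> \<in> semigroup_gen ns - set ns \<and> coprime \<alpha> \<beta> \<and>
     T = {a + \<beta> * s |a s. a \<in> semigroup_gen [\<alpha>] \<and> s \<in> semigroup_gen ns}"

end

theory Submission
  imports Defs
begin

text \<open>The face whose relative interior contains \<open>x\<close> spans the space cut out by the inequalities
  that are tight at \<open>x\<close>. At an Apery tuple this is the space of functions on \<open>Ap(S;m)\<close> that are
  additive wherever the sum stays in \<open>Ap(S;m)\<close>. Since
  \<open>Ap(T;\<beta>m) = {k\<alpha> + \<beta>a | k < \<beta>, a \<in> Ap(S;m)}\<close> with unique representations, such a function on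
  \<open>Ap(T;\<beta>m)\<close> has the form \<open>k\<alpha> + \<beta>a \<mapsto> kc + f(a)\<close> with \<open>f\<close> additive on \<open>Ap(S;m)\<close>. A carry
  \<open>k + l \<ge> \<beta>\<close> between two elements whose sum stays in \<open>Ap(T;\<beta>m)\<close> is possible only if
  \<open>\<alpha> \<in> Ap(S;m)\<close>; then it forces \<open>\<beta>c = f(\<alpha>)\<close>, and otherwise \<open>c\<close> is a free parameter.\<close>

section \<open>Faces of polyhedral cones\<close>

text \<open>The affine hull of \<open>F\<close> is the subspace of vectors on which every inequality
  tight at \<open>x\<close> vanishes. Tightness at a relative interior point propagates to all of
  \<open>F\<close>; conversely, a small move from \<open>x\<close> inside that subspace violates no
  inequality, and the face property keeps it in \<open>F\<close>.\<close>

lemma aff_dim_face_of_cone: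
  fixes V :: "'a::euclidean_space set" and h :: "'i \<Rightarrow> 'a \<Rightarrow> real"
  assumes V: "subspace V" and I: "finite I" and h: "\<And>i. i \<in> I \<Longrightarrow> linear (h i)"
    and F: "F face_of {x \<in> V. \<forall>i\<in>I. h i x \<ge> 0}" and x: "x \<in> rel_interior F"
  shows "aff_dim F = int (dim {y \<in> V. \<forall>i\<in>I. h i x = 0 \<longrightarrow> h i y = 0})"
proof -
  define L where "L = {y \<in> V. \<forall>i\<in>I. h i x = 0 \<longrightarrow> h i y = 0}"
  have sub: "F \<subseteq> {x \<in> V. \<forall>i\<in>I. h i x \<ge> 0}" and conv: "convex F"
    using F by (auto simp: face_of_def)
  have xF: "x \<in> F" using x rel_interior_subset by blast
  have "subspace L"
    unfolding L_def using V h
    by (auto simp: subspace_def linear_0 linear_add linear_scale)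
  have "F \<subseteq> L"
  proof
    fix y assume y: "y \<in> F"
    \<comment> \<open>As \<open>e > 1\<close>, this point of \<open>F\<close> lies beyond
      \<open>x\<close> on the line from \<open>y\<close>. Where \<open>h i\<close> vanishes at
      \<open>x\<close>, it has opposite signs at \<open>y\<close> and there, yet is nonnegative at
      both.\<close>
    obtain e where e: "e > 1" "(1 - e) *\<^sub>R y + e *\<^sub>R x \<in> F"
      using x y convex_rel_interior_iff[OF conv] by blast
    have "h i y = 0" if i: "i \<in> I" "h i x = 0" for i
    proof -
      have "0 \<le> h i ((1 - e) *\<^sub>R y + e *\<^sub>R x)" using sub e(2) i by auto
      also have "\<dots> = (1 - e) * h i y"
        using i h[OF i(1)] by (simp add: linear_add linear_scale)
      finally have "h i y \<le> 0" using e(1) by (simp add: zero_le_mult_iff)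
      moreover have "h i y \<ge> 0" using sub y i by auto
      ultimately show ?thesis by simp
    qed
    then show "y \<in> L" using sub y by (auto simp: L_def)
  qed
  have step: "\<exists>e>0. x + e *\<^sub>R v \<in> F" if v: "v \<in> L" "v \<noteq> 0" for v
  proof -
    \<comment> \<open>Tight inequalities stay tight along \<open>v\<close>, and slack ones stay
      positive for small \<open>e\<close>. Both signs are needed because the face property is
      applied to a segment with midpoint \<open>x\<close>.\<close>
    have "\<forall>\<^sub>F e in at_right 0. h i x + e * h i v \<ge> 0 \<and> h i x - e * h i v \<ge> 0"
      if i: "i \<in> I" for i
    proof (cases "h i x = 0")
      case True
      then show ?thesis using v i by (simp add: L_def)
    next
      case False
      then have "h i x > 0" using sub xF i by force
      moreover have "((\<lambda>e. h i x + e * h i v) \<longlongrightarrow> h i x) (at_right 0)"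
        "((\<lambda>e. h i x - e * h i v) \<longlongrightarrow> h i x) (at_right 0)"
        by (auto intro!: tendsto_eq_intros)
      ultimately have "\<forall>\<^sub>F e in at_right 0. 0 < h i x + e * h i v"
        "\<forall>\<^sub>F e in at_right 0. 0 < h i x - e * h i v"
        by (auto dest: order_tendstoD(1))
      then show ?thesis by eventually_elim auto
    qed
    then have "\<forall>\<^sub>F e in at_right 0. \<forall>i\<in>I. h i x + e * h i v \<ge> 0 \<and> h i x - e * h i v \<ge> 0"
      using I by (simp add: eventually_ball_finite)
    then have "\<forall>\<^sub>F e in at_right (0::real). e > 0 \<and>
        (\<forall>i\<in>I. h i x + e * h i v \<ge> 0 \<and> h i x - e * h i v \<ge> 0)"
      using eventually_at_right_less[of "0::real"] by eventually_elim auto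
    then obtain e :: real where e: "e > 0"
      "\<And>i. i \<in> I \<Longrightarrow> h i x + e * h i v \<ge> 0 \<and> h i x - e * h i v \<ge> 0"
      by (blast dest: eventually_happens'[OF trivial_limit_at_right_real])
    have mem: "x + c *\<^sub>R v \<in> {x \<in> V. \<forall>i\<in>I. h i x \<ge> 0}" if "c = e \<or> c = - e" for c
    proof -
      have "x \<in> V" "v \<in> V" using sub xF v by (auto simp: L_def)
      then show ?thesis
        using e(2) h that V
        by (auto simp: linear_add linear_scale subspace_add subspace_scale)
    qed
    have "x \<in> open_segment (x + e *\<^sub>R v) (x + (- e) *\<^sub>R v)"
    proof -
      have "x = midpoint (x + e *\<^sub>R v) (x + (- e) *\<^sub>R v)"
        by (simp add: midpoint_def scaleR_2[symmetric])
      moreover have "x + e *\<^sub>R v \<noteq> x + (- e) *\<^sub>R v" using e(1) v(2)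
        by (metis add_left_cancel less_irrefl neg_equal_zero scaleR_cancel_right)
      ultimately show ?thesis by (metis midpoint_in_open_segment)
    qed
    then have "x + e *\<^sub>R v \<in> F"
      using F mem xF unfolding face_of_def by blast
    then show ?thesis using e(1) by blast
  qed
  have "L \<subseteq> affine hull F"
  proof
    fix y assume y: "y \<in> L"
    show "y \<in> affine hull F"
    proof (cases "y = x")
      case True
      then show ?thesis using xF by (simp add: hull_inc)
    next
      case False
      have "y - x \<in> L" using y xF \<open>F \<subseteq> L\<close> \<open>subspace L\<close> by (auto intro: subspace_diff)
      then obtain e where e: "e > 0" "x + e *\<^sub>R (y - x) \<in> F"
        using step[of "y - x"] False by auto
      \<comment> \<open>Undoes the scaling: \<open>y\<close> lies on the line through the two points
        \<open>x\<close> and \<open>x + e *\<^sub>R (y - x)\<close> of \<open>F\<close>.\<close>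
      have "y = (1 - 1 / e) *\<^sub>R x + (1 / e) *\<^sub>R (x + e *\<^sub>R (y - x))"
        using e(1) by (simp add: algebra_simps)
      moreover have "(1 - 1 / e) *\<^sub>R x + (1 / e) *\<^sub>R (x + e *\<^sub>R (y - x)) \<in> affine hull F"
        by (rule mem_affine) (use xF e in \<open>auto simp: hull_inc\<close>)
      ultimately show ?thesis by simp
    qed
  qed
  moreover have "affine hull F \<subseteq> L"
    using \<open>F \<subseteq> L\<close> \<open>subspace L\<close> by (intro hull_minimal subspace_imp_affine) auto
  ultimately have "affine hull F = L" by blast
  then have "aff_dim F = aff_dim L" by (metis aff_dim_affine_hull)
  then show ?thesis using \<open>subspace L\<close> by (simp add: aff_dim_subspace L_def)
qed

section \<open>Residues and Apery sets\<close>

text \<open>Replaces \<^const>\<open>of_nat\<close>, which is not available on \<^typ>\<open>'m mod_ring\<close> when \<open>CARD('m) = 1\<close>.\<close>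

definition residue :: "nat \<Rightarrow> 'm::finite mod_ring" where
  "residue n = of_int_mod_ring (int n)"

lemma residue_add: "residue (a + b) = residue a + residue b"
  unfolding residue_def by transfer (simp add: mod_simps)

lemma residue_0: "residue 0 = 0"
  by (simp add: residue_def)

lemma residue_eq_iff:
  "(residue a :: 'm::finite mod_ring) = residue b \<longleftrightarrow> [a = b] (mod CARD('m))"
  unfolding residue_def
  by transfer (simp add: cong_def flip: of_nat_mod)

lemma surj_residue: "surj (residue :: nat \<Rightarrow> 'm::finite mod_ring)"
proof (rule surjI)
  fix i :: "'m mod_ring"
  have "0 \<le> to_int_mod_ring i" using range_to_int_mod_ring[where 'a='m] by auto
  then show "residue (nat (to_int_mod_ring i)) = i" by (simp add: residue_def)
qed

lemma add_mult_mem: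
  fixes S :: "nat set"
  assumes "\<And>a b. a \<in> S \<Longrightarrow> b \<in> S \<Longrightarrow> a + b \<in> S" "m \<in> S" "a \<in> S"
  shows "a + k * m \<in> S"
proof (induction k)
  case (Suc k)
  then show ?case using assms(1)[OF assms(2) Suc] by (simp add: ac_simps)
qed (use assms in simp)

text \<open>Two congruent elements of \<open>S\<close> differ by a multiple of the modulus; if they
  are distinct, taking one modulus off the larger one stays in \<open>S\<close>, so the larger one
  is not an Apery element.\<close>

lemma inj_on_residue_apery:
  assumes add: "\<And>a b. a \<in> S \<Longrightarrow> b \<in> S \<Longrightarrow> a + b \<in> S" and m: "CARD('m) \<in> S"
  shows "inj_on (residue :: nat \<Rightarrow> 'm::finite mod_ring) (apery S CARD('m))"
proof (rule linorder_inj_onI)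
  fix a b assume ab: "a < b" "a \<in> apery S CARD('m)" "b \<in> apery S CARD('m)"
  show "(residue a :: 'm mod_ring) \<noteq> residue b"
  proof
    assume "(residue a :: 'm mod_ring) = residue b"
    then have "[b = a] (mod CARD('m))" by (simp add: residue_eq_iff cong_sym)
    then obtain k where k: "b = a + k * CARD('m)"
      using ab(1) cong_le_nat[of a b] by (metis cong_sym less_imp_le mult.commute add.commute)
    with ab(1) obtain l where l: "k = Suc l" by (cases k) auto
    have "a + l * CARD('m) \<in> S" using ab(2) add m by (intro add_mult_mem) (auto simp: apery_def)
    then show False using ab(3) k l by (simp add: apery_def)
  qed
qed auto

text \<open>For surjectivity, the least element of \<open>S\<close> in a residue class is an Apery
  element.\<close>

lemma bij_betw_residue_apery:
  assumes S: "numerical_semigroup S" and m: "CARD('m) \<in> S"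
  shows "bij_betw (residue :: nat \<Rightarrow> 'm::finite mod_ring) (apery S CARD('m)) UNIV"
proof -
  have "i \<in> residue ` apery S CARD('m)" for i :: "'m mod_ring"
  proof -
    obtain n where n: "i = residue n" using surj_residue by blast
    \<comment> \<open>An infinite progression cannot lie in the finite complement of
      \<open>S\<close>, so the class of \<open>n\<close> meets \<open>S\<close>.\<close>
    have "infinite (range (\<lambda>k. n + k * CARD('m)))"
      by (intro range_inj_infinite) (auto simp: inj_on_def)
    then have "\<not> range (\<lambda>k. n + k * CARD('m)) \<subseteq> UNIV - S"
      using S finite_subset unfolding numerical_semigroup_def by blast
    then obtain k where k: "n + k * CARD('m) \<in> S" by auto
    have "residue (n + k * CARD('m)) = i"
      unfolding n by (simp add: residue_eq_iff cong_def)
    with k have ex: "\<exists>s. s \<in> S \<and> residue s = i" by blast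
    define s where "s = (LEAST s. s \<in> S \<and> residue s = i)"
    have s: "s \<in> S" "residue s = i" using LeastI_ex[OF ex] by (auto simp: s_def)
    have "s - CARD('m) \<notin> S" if "CARD('m) \<le> s"
    proof
      assume "s - CARD('m) \<in> S"
      moreover have "(residue (s - CARD('m)) :: 'm mod_ring) = residue s"
        using that by (simp add: residue_eq_iff cong_def le_mod_geq)
      ultimately have "s \<le> s - CARD('m)"
        using s(2) unfolding s_def by (intro Least_le) auto
      moreover have "CARD('m) > 0" by simp
      ultimately show False using that by linarith
    qed
    then have "s \<in> apery S CARD('m)" using s by (simp add: apery_def)
    then show ?thesis using s(2) by blast
  qed
  then show ?thesis
    using inj_on_residue_apery[of S] S m unfolding bij_betw_def numerical_semigroup_def by blast
qed

text \<open>A function on \<open>A\<close> is encoded as a vector indexed by residues, so this is meaningful only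
  when \<^const>\<open>residue\<close> is a bijection from \<open>A\<close> onto \<^typ>\<open>'m mod_ring\<close>.\<close>

definition kunz_space :: "nat set \<Rightarrow> (real ^ 'm::finite mod_ring) set" where
  "kunz_space A = {y. \<forall>a\<in>A. \<forall>b\<in>A. a + b \<in> A \<longrightarrow>
     y $ residue (a + b) = y $ residue a + y $ residue b}"

lemma kunz_spaceD:
  "y \<in> kunz_space A \<Longrightarrow> a \<in> A \<Longrightarrow> b \<in> A \<Longrightarrow> a + b \<in> A \<Longrightarrow>
    y $ residue (a + b) = y $ residue a + y $ residue b"
  by (simp add: kunz_space_def)

lemma kunz_space_residue_0:
  "y \<in> kunz_space A \<Longrightarrow> 0 \<in> A \<Longrightarrow> y $ 0 = 0"
  using kunz_spaceD[of y A 0 0] by (simp add: residue_0)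

lemma subspace_kunz_space: "subspace (kunz_space A :: (real ^ 'm::finite mod_ring) set)"
  by (auto simp: subspace_def kunz_space_def algebra_simps)

section \<open>Apery tuples and the faces containing them\<close>

lemma apery_tuple_residue:
  assumes "inj_on (residue :: nat \<Rightarrow> 'm mod_ring) (apery S CARD('m))"
    and "0 \<in> apery S CARD('m)" and "a \<in> apery S CARD('m)"
  shows "(apery_tuple S :: real ^ 'm::finite mod_ring) $ residue a = real a"
proof (cases "(residue a :: 'm mod_ring) = 0")
  case True
  then have "(residue a :: 'm mod_ring) = residue 0" by (simp add: residue_0)
  \<comment> \<open>The Apery element of residue 0 is 0 itself, so the value 0 put at the zero
    coordinate is the right one.\<close>
  then have "a = 0" using assms unfolding inj_on_def by blast
  then show ?thesis by (simp add: apery_tuple_def residue_0)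
next
  case False
  have "(THE b. b \<in> apery S CARD('m) \<and> (residue b :: 'm mod_ring) = residue a) = a"
    using assms by (auto simp: inj_on_def)
  then show ?thesis using False by (simp add: apery_tuple_def residue_def)
qed

text \<open>The inequality indexed by the residues of Apery elements \<open>a\<close> and
  \<open>b\<close> is tight at the Apery tuple exactly when \<open>a + b\<close> is again an Apery
  element. Hence the tight equations are those of \<open>kunz_space\<close>.\<close>

lemma aff_dim_face_contains:
  fixes F :: "(real ^ 'm::finite mod_ring) set"
  assumes F: "face_contains F S"
    and add: "\<And>a b. a \<in> S \<Longrightarrow> b \<in> S \<Longrightarrow> a + b \<in> S" and S0: "0 \<in> S"
    and bij: "bij_betw (residue :: nat \<Rightarrow> 'm mod_ring) (apery S CARD('m)) UNIV"
  shows "aff_dim F = int (dim (kunz_space (apery S CARD('m)) :: (real ^ 'm mod_ring) set))"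
proof -
  let ?A = "apery S CARD('m)"
  let ?x = "apery_tuple S :: real ^ 'm mod_ring"
  define I where "I = {(i, j). i \<noteq> (0 :: 'm mod_ring) \<and> j \<noteq> 0 \<and> i + j \<noteq> 0}"
  define h where "h = (\<lambda>(i, j) (y :: real ^ 'm mod_ring). y $ i + y $ j - y $ (i + j))"
  define V where "V = {y :: real ^ 'm mod_ring. y $ 0 = 0}"
  have inj: "inj_on (residue :: nat \<Rightarrow> 'm mod_ring) ?A" using bij by (rule bij_betw_imp_inj_on)
  have A0: "0 \<in> ?A" using S0 by (simp add: apery_def)
  have res0: "(residue a :: 'm mod_ring) = 0 \<longleftrightarrow> a = 0" if "a \<in> ?A" for a
    using inj_onD[OF inj, of a 0] A0 that by (auto simp: residue_0)
  note x = apery_tuple_residue[OF inj A0]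
  have surj: "\<exists>a\<in>?A. i = residue a" for i :: "'m mod_ring"
    using bij unfolding bij_betw_def by blast
  have cone: "group_cone = {y \<in> V. \<forall>p\<in>I. h p y \<ge> 0}"
    by (auto simp: group_cone_def V_def I_def h_def)
  \<comment> \<open>The coordinate at the residue of \<open>a + b\<close> is the Apery element
    \<open>c\<close> of that class, so tightness says \<open>a + b = c\<close>.\<close>
  have tight: "?x $ residue a + ?x $ residue b = ?x $ residue (a + b) \<longleftrightarrow> a + b \<in> ?A"
    if ab: "a \<in> ?A" "b \<in> ?A" for a b
  proof
    assume eq: "?x $ residue a + ?x $ residue b = ?x $ residue (a + b)"
    obtain c where c: "c \<in> ?A" "(residue (a + b) :: 'm mod_ring) = residue c"
      using surj by blast
    have "real (a + b) = real c" using eq x ab c by simp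
    then show "a + b \<in> ?A" using c(1) by (simp only: of_nat_eq_iff)
  next
    assume "a + b \<in> ?A"
    then show "?x $ residue a + ?x $ residue b = ?x $ residue (a + b)"
      using x ab by simp
  qed
  have "{y \<in> V. \<forall>p\<in>I. h p ?x = 0 \<longrightarrow> h p y = 0} = kunz_space ?A" (is "?L = _")
  proof (intro equalityI subsetI)
    fix y assume y: "y \<in> ?L"
    show "y \<in> kunz_space ?A"
      unfolding kunz_space_def
    proof (intro CollectI ballI impI)
      fix a b assume ab: "a \<in> ?A" "b \<in> ?A" "a + b \<in> ?A"
      show "y $ residue (a + b) = y $ residue a + y $ residue b"
      \<comment> \<open>Zero summands are excluded from \<open>I\<close>; their equations come from
        the vanishing zero coordinate in \<open>V\<close>.\<close>
      proof (cases "a = 0 \<or> b = 0")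
        case True
        then show ?thesis using y by (auto simp: V_def residue_0)
      next
        case False
        then have "(residue a, residue b) \<in> I"
          using ab res0[of a] res0[of b] res0[of "a + b"] by (simp add: I_def flip: residue_add)
        moreover have "h (residue a, residue b) ?x = 0"
          using tight[OF ab(1,2)] ab(3) by (simp add: h_def flip: residue_add)
        ultimately have "h (residue a, residue b) y = 0" using y by blast
        then show ?thesis by (simp add: h_def flip: residue_add)
      qed
    qed
  next
    fix y :: "real ^ 'm mod_ring" assume y: "y \<in> kunz_space ?A"
    have "h (i, j) y = 0" if "h (i, j) ?x = 0" for i j
    proof -
      obtain a b where ab: "a \<in> ?A" "b \<in> ?A" "i = residue a" "j = residue b"
        using surj by meson
      then have "a + b \<in> ?A"
        using tight[OF ab(1,2)] that by (simp add: h_def flip: residue_add)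
      then show ?thesis
        using kunz_spaceD[OF y ab(1,2)] ab(3,4) by (simp add: h_def flip: residue_add)
    qed
    moreover have "y \<in> V" using kunz_space_residue_0[OF y A0] by (simp add: V_def)
    ultimately show "y \<in> ?L" by auto
  qed
  moreover have "aff_dim F = int (dim ?L)"
  proof (rule aff_dim_face_of_cone)
    show "subspace V" by (simp add: V_def subspace_def)
    show "finite I" by simp
    show "linear (h p)" for p
      by (cases p) (auto simp: h_def linear_iff algebra_simps)
    show "F face_of {y \<in> V. \<forall>p\<in>I. h p y \<ge> 0}" "?x \<in> rel_interior F"
      using F by (auto simp: face_contains_def cone)
  qed
  ultimately show ?thesis by simp
qed

section \<open>Gluing\<close>

context
  fixes S T :: "nat set" and m \<alpha> \<beta> :: nat
  assumes zero: "0 \<in> S" and add: "a \<in> S \<Longrightarrow> b \<in> S \<Longrightarrow> a + b \<in> S"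
    and m: "m \<in> S" "m > 0" and \<alpha>: "\<alpha> \<in> S" and \<beta>: "\<beta> \<ge> 2" and coprime: "coprime \<alpha> \<beta>"
    and T: "T = {k * \<alpha> + \<beta> * s |k s. s \<in> S}"
begin

text \<open>Modulo \<beta> only the multiple of \<alpha> survives, and \<alpha> is invertible
  there.\<close>

lemma normal_form_unique:
  assumes "k * \<alpha> + \<beta> * a = l * \<alpha> + \<beta> * b" "k < \<beta>" "l < \<beta>"
  shows "k = l \<and> a = b"
proof -
  have "[k * \<alpha> = l * \<alpha>] (mod \<beta>)"
    using assms(1) by (metis cong_def mod_mult_self2)
  then have "[k = l] (mod \<beta>)"
    using coprime cong_mult_rcancel_nat by blast
  then have "k = l" using assms by (simp add: cong_def)
  then show ?thesis using assms \<beta> by simp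
qed

text \<open>Divide the coefficient of \<alpha> by \<beta>: the quotient part is \<beta> times a
  multiple of \<alpha>, which \<beta>S absorbs since \<alpha> is in \<open>S\<close>.\<close>

lemma normal_form:
  assumes "t \<in> T"
  obtains k s where "k < \<beta>" "s \<in> S" "t = k * \<alpha> + \<beta> * s"
proof -
  obtain j s where js: "s \<in> S" "t = j * \<alpha> + \<beta> * s" using assms T by auto
  have "j * \<alpha> = (j mod \<beta> + \<beta> * (j div \<beta>)) * \<alpha>" by simp
  then have "t = (j mod \<beta>) * \<alpha> + \<beta> * (s + (j div \<beta>) * \<alpha>)"
    unfolding js(2) by (simp only: algebra_simps)
  moreover have "s + (j div \<beta>) * \<alpha> \<in> S" using add \<alpha> js(1) by (rule add_mult_mem)
  ultimately show ?thesis using that[of "j mod \<beta>"] \<beta> by simp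
qed

lemma normal_form_mem_iff:
  assumes k: "k < \<beta>"
  shows "k * \<alpha> + \<beta> * s \<in> T \<longleftrightarrow> s \<in> S"
proof
  assume "k * \<alpha> + \<beta> * s \<in> T"
  then obtain l r where "l < \<beta>" "r \<in> S" "k * \<alpha> + \<beta> * s = l * \<alpha> + \<beta> * r"
    by (rule normal_form)
  then show "s \<in> S" using normal_form_unique[of k s l r] k by simp
qed (auto simp: T)

text \<open>Subtracting \<open>\<beta> * m\<close> keeps the coefficient \<open>k\<close> and
  replaces \<open>s\<close> by \<open>s - m\<close>, so by uniqueness the two Apery conditions
  agree.\<close>

lemma normal_form_mem_apery_iff:
  assumes k: "k < \<beta>"
  shows "k * \<alpha> + \<beta> * s \<in> apery T (\<beta> * m) \<longleftrightarrow> s \<in> apery S m"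
proof -
  have "\<beta> * m \<le> k * \<alpha> + \<beta> * s \<and> k * \<alpha> + \<beta> * s - \<beta> * m \<in> T \<longleftrightarrow> m \<le> s \<and> s - m \<in> S"
  proof
    assume L: "\<beta> * m \<le> k * \<alpha> + \<beta> * s \<and> k * \<alpha> + \<beta> * s - \<beta> * m \<in> T"
    then obtain l r where lr: "l < \<beta>" "r \<in> S" "k * \<alpha> + \<beta> * s - \<beta> * m = l * \<alpha> + \<beta> * r"
      using normal_form by blast
    then have "k * \<alpha> + \<beta> * s = l * \<alpha> + \<beta> * r + \<beta> * m"
      using L le_imp_diff_is_add by blast
    then have "k * \<alpha> + \<beta> * s = l * \<alpha> + \<beta> * (r + m)"
      by (simp add: distrib_left)
    then show "m \<le> s \<and> s - m \<in> S" using normal_form_unique[of k s l "r + m"] k lr by simp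
  next
    assume R: "m \<le> s \<and> s - m \<in> S"
    then have "k * \<alpha> + \<beta> * s - \<beta> * m = k * \<alpha> + \<beta> * (s - m)"
      by (simp add: diff_mult_distrib2)
    then show "\<beta> * m \<le> k * \<alpha> + \<beta> * s \<and> k * \<alpha> + \<beta> * s - \<beta> * m \<in> T"
      using R normal_form_mem_iff[OF k] by (simp add: trans_le_add2)
  qed
  then show ?thesis unfolding apery_def using normal_form_mem_iff[OF k] by blast
qed

lemma apery_T: "apery T (\<beta> * m) = (\<lambda>(k, a). k * \<alpha> + \<beta> * a) ` ({..<\<beta>} \<times> apery S m)"
proof -
  have "t \<in> (\<lambda>(k, a). k * \<alpha> + \<beta> * a) ` ({..<\<beta>} \<times> apery S m)" if t: "t \<in> apery T (\<beta> * m)" for t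
  proof -
    obtain k s where "k < \<beta>" "s \<in> S" "t = k * \<alpha> + \<beta> * s"
      using normal_form t by (auto simp: apery_def)
    then show ?thesis using t normal_form_mem_apery_iff by force
  qed
  then show ?thesis using normal_form_mem_apery_iff by auto
qed

lemma inj_on_normal_form: "inj_on (\<lambda>(k, a). k * \<alpha> + \<beta> * a) ({..<\<beta>} \<times> A)"
  by (rule inj_onI) (auto dest: normal_form_unique)

lemma T_closed: "a \<in> T \<Longrightarrow> b \<in> T \<Longrightarrow> a + b \<in> T"
proof -
  assume "a \<in> T" "b \<in> T"
  then obtain k s l r where "s \<in> S" "r \<in> S" "a = k * \<alpha> + \<beta> * s" "b = l * \<alpha> + \<beta> * r"
    using T by auto
  then have "a + b = (k + l) * \<alpha> + \<beta> * (s + r)" "s + r \<in> S"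
    using add by (auto simp: algebra_simps)
  then show ?thesis using T by blast
qed

lemma zero_T: "0 \<in> T"
  using normal_form_mem_iff[of 0 0] zero \<beta> by simp

lemma zero_apery: "0 \<in> apery S m"
  using zero m by (simp add: apery_def)

text \<open>If \<open>a - m\<close> were in \<open>S\<close>, adding \<open>b\<close> would put
  \<open>a + b - m\<close> in \<open>S\<close>. Thus summands in \<open>S\<close> of an Apery
  element are Apery elements, which is what controls carries.\<close>

lemma add_mem_aperyD: "a + b \<in> apery S m \<Longrightarrow> a \<in> S \<Longrightarrow> b \<in> S \<Longrightarrow> a \<in> apery S m"
  using add[of "a - m" b] by (auto simp: apery_def)

text \<open>Surjectivity by counting: normal forms give \<open>\<beta> * m\<close> Apery elements,
  as many as there are residue classes.\<close>

lemma bij_betw_residue_apery_T: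
  assumes card: "CARD('m::finite) = m" "CARD('bm::finite) = \<beta> * m"
    and bij: "bij_betw (residue :: nat \<Rightarrow> 'm mod_ring) (apery S m) UNIV"
  shows "bij_betw (residue :: nat \<Rightarrow> 'bm mod_ring) (apery T (\<beta> * m)) UNIV"
proof -
  have "\<beta> * m \<in> T" using normal_form_mem_iff[of 0 m] m \<beta> by simp
  then have inj: "inj_on (residue :: nat \<Rightarrow> 'bm mod_ring) (apery T (\<beta> * m))"
    using inj_on_residue_apery[where 'm='bm, of T] T_closed card by simp
  have "card (apery T (\<beta> * m)) = \<beta> * card (apery S m)"
    unfolding apery_T by (simp add: card_image[OF inj_on_normal_form] card_cartesian_product)
  also have "card (apery S m) = m" using bij_betw_same_card[OF bij] card by simp
  finally have "card (range (residue :: nat \<Rightarrow> 'bm mod_ring)) \<le>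
      card ((residue :: nat \<Rightarrow> 'bm mod_ring) ` apery T (\<beta> * m))"
    using card surj_residue[where 'm='bm] by (simp add: card_image[OF inj])
  then have "(residue :: nat \<Rightarrow> 'bm mod_ring) ` apery T (\<beta> * m) = UNIV"
    using surj_residue[where 'm='bm] by (intro card_seteq) auto
  then show ?thesis using inj by (simp add: bij_betw_def)
qed

text \<open>The injective linear map \<open>\<Phi>\<close> parametrizes the additive functions on
  the Apery set of \<open>T\<close> by pairs \<open>(f, c)\<close>. The admissible pairs form the
  graph of a linear map if \<alpha> is an Apery element of \<open>S\<close>, and a product with the
  real line otherwise.\<close>

lemma dim_kunz_space_T:
  assumes card: "CARD('m::finite) = m" "CARD('bm::finite) = \<beta> * m"
    and bij: "bij_betw (residue :: nat \<Rightarrow> 'm mod_ring) (apery S m) UNIV"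
  shows "dim (kunz_space (apery T (\<beta> * m)) :: (real ^ 'bm mod_ring) set) =
    dim (kunz_space (apery S m) :: (real ^ 'm mod_ring) set) + (if \<alpha> \<in> apery S m then 0 else 1)"
proof -
  let ?A = "apery S m"
  let ?LS = "kunz_space ?A :: (real ^ 'm mod_ring) set"
  let ?LT = "kunz_space (apery T (\<beta> * m)) :: (real ^ 'bm mod_ring) set"
  define nf where "nf = (\<lambda>(k, a). k * \<alpha> + \<beta> * a)"
  have bijT: "bij_betw (residue \<circ> nf :: nat \<times> nat \<Rightarrow> 'bm mod_ring) ({..<\<beta>} \<times> ?A) UNIV"
    using bij_betw_residue_apery_T[OF card bij] inj_on_normal_form unfolding apery_T nf_def
    by (intro bij_betw_trans[of _ _ "nf ` ({..<\<beta>} \<times> ?A)"]) (auto simp: bij_betw_def nf_def)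
  \<comment> \<open>Decodes a residue modulo \<open>\<beta> * m\<close> into the normal form of its
    Apery element.\<close>
  define P where "P = inv_into ({..<\<beta>} \<times> ?A) (residue \<circ> nf :: nat \<times> nat \<Rightarrow> 'bm mod_ring)"
  have P: "P (residue (k * \<alpha> + \<beta> * a)) = (k, a)" if "k < \<beta>" "a \<in> ?A" for k a
    using bij_betw_inv_into_left[OF bijT, of "(k, a)"] that by (simp add: P_def nf_def)
  have ex: "\<exists>k<\<beta>. \<exists>a\<in>?A. i = residue (k * \<alpha> + \<beta> * a)" for i :: "'bm mod_ring"
  proof -
    have "i \<in> (residue \<circ> nf) ` ({..<\<beta>} \<times> ?A)" using bijT by (simp add: bij_betw_def)
    then show ?thesis by (auto simp: nf_def)
  qed
  define \<Phi> :: "(real ^ 'm mod_ring) \<times> real \<Rightarrow> real ^ 'bm mod_ring" where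
    "\<Phi> = (\<lambda>(f, c). \<chi> i. real (fst (P i)) * c + f $ residue (snd (P i)))"
  have \<Phi>: "\<Phi> (f, c) $ residue (k * \<alpha> + \<beta> * a) = real k * c + f $ residue a"
    if "k < \<beta>" "a \<in> ?A" for f c k a
    using P[OF that] by (simp add: \<Phi>_def)
  have lin: "linear \<Phi>"
    by (auto simp: linear_iff \<Phi>_def vec_eq_iff algebra_simps)
  have inj: "inj \<Phi>"
  proof (rule linear_injective_0[OF lin, THEN iffD2], intro allI impI)
    fix p assume p: "\<Phi> p = 0"
    obtain f c where fc: "p = (f, c)" by fastforce
    have f: "f $ residue a = 0" if "a \<in> ?A" for a
      using \<Phi>[of 0 a f c] that p fc \<beta> by simp
    have "f $ i = 0" for i
      using f bij unfolding bij_betw_def by (metis UNIV_I imageE)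
    then have "f = 0" by (simp add: vec_eq_iff)
    \<comment> \<open>The value at \<alpha>, whose normal form has \<open>k = 1 < \<beta>\<close>
      and \<open>a = 0\<close>, isolates \<open>c\<close> because \<open>f\<close> vanishes at
      0.\<close>
    moreover have "c = 0" using \<Phi>[of 1 0 f c] \<beta> zero_apery p fc f[OF zero_apery] by simp
    ultimately show "p = 0" using fc by (simp add: zero_prod_def)
  qed
  have key: "\<Phi> (f, c) \<in> ?LT \<longleftrightarrow> f \<in> ?LS \<and> (\<alpha> \<in> ?A \<longrightarrow> \<beta> * c = f $ residue \<alpha>)"
    for f and c :: real
  proof
    assume LT: "\<Phi> (f, c) \<in> ?LT"
    have "f \<in> ?LS"
      unfolding kunz_space_def
    proof (intro CollectI ballI impI)
      fix a b assume ab: "a \<in> ?A" "b \<in> ?A" "a + b \<in> ?A"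
      show "f $ residue (a + b) = f $ residue a + f $ residue b"
        using kunz_spaceD[OF LT, of "\<beta> * a" "\<beta> * b"] \<Phi>[of 0 _ f c] \<beta> ab
          normal_form_mem_apery_iff[of 0]
        by (simp flip: distrib_left)
    qed
    moreover have "\<beta> * c = f $ residue \<alpha>" if "\<alpha> \<in> ?A"
    proof -
      have f0: "f $ 0 = 0" using kunz_space_residue_0[OF \<open>f \<in> ?LS\<close> zero_apery] .
      \<comment> \<open>Both summands have coefficients below \<beta>, but their sum has normal form
        \<open>0 * \<alpha> + \<beta> * \<alpha>\<close>. Additivity across this carry forces the
        constraint on \<open>c\<close>.\<close>
      have sum: "\<alpha> + (\<beta> - 1) * \<alpha> = \<beta> * \<alpha>" using \<beta> by (cases \<beta>) auto
      have "\<Phi> (f, c) $ residue (\<alpha> + (\<beta> - 1) * \<alpha>) =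
          \<Phi> (f, c) $ residue \<alpha> + \<Phi> (f, c) $ residue ((\<beta> - 1) * \<alpha>)"
        using \<beta> zero_apery that normal_form_mem_apery_iff[of 1 0]
          normal_form_mem_apery_iff[of "\<beta> - 1" 0] normal_form_mem_apery_iff[of 0 \<alpha>]
        by (intro kunz_spaceD[OF LT]) (simp_all add: sum[simplified])
      then have "f $ residue \<alpha> = c + real (\<beta> - 1) * c"
        unfolding sum using \<Phi>[of 1 0 f c] \<Phi>[of "\<beta> - 1" 0 f c] \<Phi>[of 0 \<alpha> f c] \<beta> zero_apery that f0
        by (simp add: residue_0)
      then show ?thesis using \<beta> by (simp add: of_nat_diff algebra_simps)
    qed
    ultimately show "f \<in> ?LS \<and> (\<alpha> \<in> ?A \<longrightarrow> \<beta> * c = f $ residue \<alpha>)" by blast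
  next
    assume R: "f \<in> ?LS \<and> (\<alpha> \<in> ?A \<longrightarrow> \<beta> * c = f $ residue \<alpha>)"
    show "\<Phi> (f, c) \<in> ?LT"
      unfolding kunz_space_def
    proof (intro CollectI ballI impI)
      fix s t assume st: "s \<in> apery T (\<beta> * m)" "t \<in> apery T (\<beta> * m)" "s + t \<in> apery T (\<beta> * m)"
      obtain k a where s: "k < \<beta>" "a \<in> ?A" "s = k * \<alpha> + \<beta> * a" using st(1) apery_T by auto
      obtain l b where t: "l < \<beta>" "b \<in> ?A" "t = l * \<alpha> + \<beta> * b" using st(2) apery_T by auto
      have in_S: "a \<in> S" "b \<in> S" using s t by (auto simp: apery_def)
      show "\<Phi> (f, c) $ residue (s + t) = \<Phi> (f, c) $ residue s + \<Phi> (f, c) $ residue t"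
      proof (cases "k + l < \<beta>")
        case True
        have eq: "s + t = (k + l) * \<alpha> + \<beta> * (a + b)" by (simp add: s t algebra_simps)
        have ab: "a + b \<in> ?A" using st(3) True normal_form_mem_apery_iff unfolding eq by blast
        have "f $ residue (a + b) = f $ residue a + f $ residue b"
          using R s t ab by (intro kunz_spaceD[of _ ?A]) auto
        then show ?thesis
          unfolding eq \<Phi>[OF True ab] unfolding s(3) t(3) \<Phi>[OF s(1,2)] \<Phi>[OF t(1,2)]
          by (simp add: algebra_simps)
      next
        case False
        then obtain r where r: "k + l = r + \<beta>"
          using le_Suc_ex[of \<beta> "k + l"] by (auto simp: add.commute)
        then have rb: "r < \<beta>" using s t by linarith
        have "s + t = (k + l) * \<alpha> + \<beta> * (a + b)" by (simp add: s t algebra_simps)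
        \<comment> \<open>The carry turns \<beta> copies of \<alpha> into one extra \<alpha> in the
          \<open>S\<close> component, leaving the coefficient
          \<open>r = k + l - \<beta>\<close>.\<close>
        then have eq: "s + t = r * \<alpha> + \<beta> * (\<alpha> + (a + b))" by (simp add: r algebra_simps)
        have \<alpha>ab: "\<alpha> + (a + b) \<in> ?A"
          using st(3) rb normal_form_mem_apery_iff unfolding eq by blast
        have \<alpha>A: "\<alpha> \<in> ?A" using add_mem_aperyD[OF \<alpha>ab] \<alpha> add in_S by blast
        have ab: "a + b \<in> ?A"
          using add_mem_aperyD[of "a + b" \<alpha>] \<alpha>ab \<alpha> add in_S by (simp add: add.commute)
        have "f $ residue (\<alpha> + (a + b)) = f $ residue \<alpha> + f $ residue (a + b)"
          using R \<alpha>A ab \<alpha>ab by (intro kunz_spaceD[of _ ?A]) auto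
        also have "f $ residue (a + b) = f $ residue a + f $ residue b"
          using R s t ab by (intro kunz_spaceD[of _ ?A]) auto
        also have "f $ residue \<alpha> = \<beta> * c" using R \<alpha>A by simp
        finally have "\<Phi> (f, c) $ residue (s + t) =
            real (r + \<beta>) * c + f $ residue a + f $ residue b"
          unfolding eq \<Phi>[OF rb \<alpha>ab] by (simp add: algebra_simps)
        then show ?thesis
          unfolding r[symmetric] unfolding s(3) t(3) \<Phi>[OF s(1,2)] \<Phi>[OF t(1,2)]
          by (simp add: algebra_simps)
      qed
    qed
  qed
  have onto: "\<exists>f c. g = \<Phi> (f, c)" if g: "g \<in> ?LT" for g
  proof -
    define w where "w = inv_into ?A (residue :: nat \<Rightarrow> 'm mod_ring)"
    have w_res: "w (residue a) = a" if "a \<in> ?A" for a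
      unfolding w_def using bij that by (rule bij_betw_inv_into_left)
    \<comment> \<open>Any preimage of \<open>g\<close> must have these parameters: \<open>f\<close>
      is the restriction of \<open>g\<close> to the multiples \<open>\<beta> * a\<close>, and
      \<open>c\<close> is its value at \<alpha>.\<close>
    define f where "f = (\<chi> i. g $ residue (\<beta> * w i))"
    define c where "c = g $ residue \<alpha>"
    have apT: "k * \<alpha> + \<beta> * a \<in> apery T (\<beta> * m)" if "k < \<beta>" "a \<in> ?A" for k a
      using that normal_form_mem_apery_iff by blast
    have g0: "g $ 0 = 0"
      using kunz_space_residue_0[OF g] apT[of 0 0] zero_apery \<beta> by simp
    \<comment> \<open>All \<open>k * \<alpha>\<close> with \<open>k < \<beta>\<close> have zero
      \<open>S\<close> component, so they are Apery elements of \<open>T\<close> whether or not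
      \<alpha> is one of \<open>S\<close>.\<close>
    have mult: "g $ residue (k * \<alpha>) = k * c" if "k < \<beta>" for k
      using that
    proof (induction k)
      case 0
      then show ?case using g0 by (simp add: residue_0)
    next
      case (Suc k)
      have "g $ residue (\<alpha> + k * \<alpha>) = g $ residue \<alpha> + g $ residue (k * \<alpha>)"
        using Suc.prems apT[of 1 0] apT[of k 0] apT[of "Suc k" 0] zero_apery
        by (intro kunz_spaceD[OF g]) simp_all
      then show ?case using Suc by (simp add: c_def algebra_simps)
    qed
    have "g $ residue (k * \<alpha> + \<beta> * a) = k * c + f $ residue a" if "k < \<beta>" "a \<in> ?A" for k a
    proof -
      have "g $ residue (k * \<alpha> + \<beta> * a) = g $ residue (k * \<alpha>) + g $ residue (\<beta> * a)"
        using that apT[of k 0] apT[of 0 a] apT[of k a] zero_apery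
        by (intro kunz_spaceD[OF g]) simp_all
      then show ?thesis using mult that w_res by (simp add: f_def)
    qed
    then have "g $ i = \<Phi> (f, c) $ i" for i using ex[of i] \<Phi> by auto
    then show ?thesis by (metis vec_eq_iff)
  qed
  show ?thesis
  proof (cases "\<alpha> \<in> ?A")
    case True
    \<comment> \<open>The constraint determines \<open>c\<close> from \<open>f\<close>, so
      \<open>f\<close> alone parametrizes the space and the dimension is unchanged.\<close>
    define \<Psi> where "\<Psi> = (\<lambda>f. \<Phi> (f, f $ residue \<alpha> / \<beta>))"
    have "linear (\<lambda>f :: real ^ 'm mod_ring. (f, f $ residue \<alpha> / \<beta>))"
      by (auto simp: linear_iff add_divide_distrib)
    then have "linear \<Psi>" unfolding \<Psi>_def
      using linear_compose[OF _ lin] by (simp add: o_def)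
    moreover have "inj_on \<Psi> (span ?LS)" using inj by (auto simp: inj_on_def \<Psi>_def)
    ultimately have "dim (\<Psi> ` ?LS) = dim ?LS" by (rule dim_image_eq)
    moreover have "?LT = \<Psi> ` ?LS"
    proof (intro equalityI subsetI)
      fix g assume g: "g \<in> ?LT"
      then obtain f c where fc: "g = \<Phi> (f, c)" using onto by blast
      with g True key[of f c] have "f \<in> ?LS" "c = f $ residue \<alpha> / \<beta>"
        using \<beta> by (auto simp: field_simps)
      then show "g \<in> \<Psi> ` ?LS" using fc by (simp add: \<Psi>_def)
    next
      fix g assume "g \<in> \<Psi> ` ?LS"
      then show "g \<in> ?LT" using key \<beta> by (auto simp: \<Psi>_def)
    qed
    ultimately show ?thesis using True by simp
  next
    case False
    \<comment> \<open>The constraint is vacuous here: \<open>c\<close> ranges freely and contributes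
      the extra dimension.\<close>
    have "?LT = \<Phi> ` (?LS \<times> UNIV)"
    proof (intro equalityI subsetI)
      fix g assume g: "g \<in> ?LT"
      then obtain f c where "g = \<Phi> (f, c)" using onto by blast
      with g key[of f c] show "g \<in> \<Phi> ` (?LS \<times> UNIV)" by auto
    qed (use key False in auto)
    moreover have "inj_on \<Phi> (span (?LS \<times> UNIV))" using inj by (rule inj_on_subset) simp
    ultimately have "dim ?LT = dim (?LS \<times> (UNIV :: real set))"
      using dim_image_eq[OF lin] by metis
    also have "\<dots> = dim ?LS + 1" by (simp add: dim_Times subspace_kunz_space)
    finally show ?thesis using False by simp
  qed
qed

end

section \<open>Generators and the dimension formula\<close>

lemma nth_mem_semigroup_gen: "n \<in> set ns \<Longrightarrow> n \<in> semigroup_gen ns"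
proof -
  assume "n \<in> set ns"
  then obtain j where j: "j < length ns" "n = ns ! j" by (auto simp: in_set_conv_nth)
  have "(\<Sum>i<length ns. (if i = j then 1 else 0) * ns ! i) = ns ! j"
    using j by (simp add: if_distrib[of "\<lambda>x. x * _"] cong: if_cong)
  then show ?thesis
    unfolding semigroup_gen_def using j by (auto intro!: exI[of _ "\<lambda>i. if i = j then 1 else 0"])
qed

lemma semigroup_gen_singleton: "semigroup_gen [n] = range (\<lambda>k. k * n)"
proof -
  have "\<exists>c :: nat \<Rightarrow> nat. k * n = c 0 * n" for k by (rule exI[of _ "\<lambda>_. k"]) simp
  then show ?thesis by (auto simp: semigroup_gen_def)
qed

theorem corollary6p12:
  fixes m \<alpha> \<beta> :: nat and ns :: "nat list" and S T :: "nat set"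
    and F :: "(real ^ 'm::finite mod_ring) set"
    and F' :: "(real ^ 'bm::finite mod_ring) set"
  assumes "CARD('m) = m" and "CARD('bm) = \<beta> * m"
    and "S = semigroup_gen (m # ns)" and "numerical_semigroup S"
    and "face_contains F S"
    and "monoscopic_gluing (m # ns) \<alpha> \<beta> T"
    and "face_contains F' T"
  shows "aff_dim F' = (if \<alpha> \<in> apery S m then aff_dim F else aff_dim F + 1)"
proof -
  have m: "m \<in> S" using assms(3) nth_mem_semigroup_gen by simp
  have glue: "\<beta> \<ge> 2" "\<alpha> \<in> S" "coprime \<alpha> \<beta>"
    and T: "T = {k * \<alpha> + \<beta> * s |k s. s \<in> S}"
    using assms(3,6) by (auto simp: monoscopic_gluing_def semigroup_gen_singleton)
  have S: "0 \<in> S" "m > 0" and add: "\<And>a b. a \<in> S \<Longrightarrow> b \<in> S \<Longrightarrow> a + b \<in> S"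
    using assms(1,4) by (auto simp: numerical_semigroup_def)
  note gluing = S(1) add m S(2) glue(2,1,3) T
  have bij: "bij_betw (residue :: nat \<Rightarrow> 'm mod_ring) (apery S m) UNIV"
    using bij_betw_residue_apery[where 'm='m] assms(1,4) m by metis
  \<comment> \<open>Both face dimensions become dimensions of spaces of additive functions on Apery
    sets, which the gluing compares.\<close>
  have "aff_dim F = int (dim (kunz_space (apery S m) :: (real ^ 'm mod_ring) set))"
    using aff_dim_face_contains[OF assms(5) add S(1)] bij assms(1) by simp
  moreover have "aff_dim F' = int (dim (kunz_space (apery T (\<beta> * m)) :: (real ^ 'bm mod_ring) set))"
    using aff_dim_face_contains[OF assms(7) T_closed[OF gluing] zero_T[OF gluing]]
      bij_betw_residue_apery_T[OF gluing assms(1,2) bij] assms(2) by simp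
  ultimately show ?thesis using dim_kunz_space_T[OF gluing assms(1,2) bij] by simp
qed

end
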